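(* Let $k$ be a field and let $R$ be a prime $k$-algebra such that each nonzero right ideal of $R$ contains a nonzero idempotent $e$ such that $Z(eRe)$ is a field. Suppose that $\dim_k(R)\le \aleph_0$. Then $R$ is both left and right primitive.
   Context: Algebras are associative and are not assumed to have an identity. For an idempotent $e\in R$, $eRe=\{ere : r\in R\}$ is the corner ring, with identity $e$, and $Z(eRe)$ denotes its center. A (nonzero) ring $R$ is prime if the product of any two nonzero two-sided ideals is nonzero; equivalently, for all nonzero $a,b\in R$ there is $x\in R$ with $axb\neq 0$. A ring is left (respectively right) primitive if it has a faithful simple left (respectively right) module. *)

theory Defs
  imports Complex_Main "HOL-Algebra.Module" "HOL-Library.Countable_Set"
begin

text \<open>
  The type class \<open>ring\<close> of HOL has no unit, while the rings of HOL-Algebra do.  The ambient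
  algebra is therefore a type of class \<open>ring\<close>; corner rings and modules have carrier sets.
\<close>

locale nonunital_algebra = vector_space scale
  for scale :: "'k::field \<Rightarrow> 'r::ring \<Rightarrow> 'r" +
  assumes scale_mult_left: "scale c x * y = scale c (x * y)"
    and scale_mult_right: "x * scale c y = scale c (x * y)"
begin

text \<open>The library function \<open>dim\<close> takes values in \<open>nat\<close>, so it cannot express \<open>\<le> \<aleph>\<^sub>0\<close>.\<close>

definition countable_dimension :: bool where
  "countable_dimension \<longleftrightarrow> (\<exists>B. independent B \<and> span B = UNIV \<and> countable B)"

end

definition right_ideal :: "'r::ring set \<Rightarrow> bool" where
  "right_ideal I \<longleftrightarrow> 0 \<in> I \<and> (\<forall>x\<in>I. \<forall>y\<in>I. x + y \<in> I) \<and> (\<forall>x\<in>I. - x \<in> I) \<and>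
     (\<forall>x\<in>I. \<forall>r. x * r \<in> I)"

definition two_sided_ideal :: "'r::ring set \<Rightarrow> bool" where
  "two_sided_ideal I \<longleftrightarrow> right_ideal I \<and> (\<forall>x\<in>I. \<forall>r. r * x \<in> I)"

inductive_set ideal_product :: "'r::ring set \<Rightarrow> 'r set \<Rightarrow> 'r set" for I J where
  prod: "\<lbrakk>x \<in> I; y \<in> J\<rbrakk> \<Longrightarrow> x * y \<in> ideal_product I J"
| sum: "\<lbrakk>s \<in> ideal_product I J; t \<in> ideal_product I J\<rbrakk> \<Longrightarrow> s + t \<in> ideal_product I J"

definition prime_ring :: "'r::ring itself \<Rightarrow> bool" where
  "prime_ring _ \<longleftrightarrow> (\<exists>x::'r. x \<noteq> 0) \<and>
     (\<forall>I J :: 'r set. two_sided_ideal I \<longrightarrow> two_sided_ideal J \<longrightarrow> I \<noteq> {0} \<longrightarrow> J \<noteq> {0} \<longrightarrow>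
        ideal_product I J \<noteq> {0})"

definition corner :: "'r::ring \<Rightarrow> 'r set" where
  "corner e = {e * r * e | r. True}"

definition center :: "'r::ring set \<Rightarrow> 'r set" where
  "center S = {z \<in> S. \<forall>x\<in>S. z * x = x * z}"

definition corner_center :: "'r::ring \<Rightarrow> 'r ring" where
  "corner_center e =
     \<lparr>carrier = center (corner e), mult = (*), one = e, zero = 0, add = (+)\<rparr>"

text \<open>
  The locale \<open>module\<close> of HOL-Algebra requires a commutative unital ring of scalars, so only its
  record type is used.  The multiplicative components of the record play no role.
\<close>

locale additive_ring_action = abelian_group M
  for M :: "('r::ring, 'm) module" (structure) +
  assumes smult_closed: "x \<in> carrier M \<Longrightarrow> r \<odot> x \<in> carrier M"
    and smult_l_distr: "x \<in> carrier M \<Longrightarrow> (r + s) \<odot> x = r \<odot> x \<oplus> s \<odot> x"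
    and smult_r_distr:
      "\<lbrakk>x \<in> carrier M; y \<in> carrier M\<rbrakk> \<Longrightarrow> r \<odot> (x \<oplus> y) = r \<odot> x \<oplus> r \<odot> y"

locale left_ring_module = additive_ring_action +
  assumes smult_assoc: "x \<in> carrier M \<Longrightarrow> (r * s) \<odot> x = r \<odot> (s \<odot> x)"

text \<open>In a right module, \<open>r \<odot> x\<close> stands for the product of \<open>x\<close> with \<open>r\<close> on the right.\<close>

locale right_ring_module = additive_ring_action +
  assumes smult_assoc: "x \<in> carrier M \<Longrightarrow> (r * s) \<odot> x = s \<odot> (r \<odot> x)"

definition ring_submodule :: "'m set \<Rightarrow> ('r::ring, 'm) module \<Rightarrow> bool" where
  "ring_submodule N M \<longleftrightarrow>
     subgroup N (add_monoid M) \<and> (\<forall>r. \<forall>x\<in>N. r \<odot>\<^bsub>M\<^esub> x \<in> N)"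

text \<open>Without a unit, simplicity must exclude the zero action on a group of prime order.\<close>

definition simple_module :: "('r::ring, 'm) module \<Rightarrow> bool" where
  "simple_module M \<longleftrightarrow>
     (\<exists>r. \<exists>x\<in>carrier M. r \<odot>\<^bsub>M\<^esub> x \<noteq> \<zero>\<^bsub>M\<^esub>) \<and>
     (\<forall>N. ring_submodule N M \<longrightarrow> N = {\<zero>\<^bsub>M\<^esub>} \<or> N = carrier M)"

definition faithful_module :: "('r::ring, 'm) module \<Rightarrow> bool" where
  "faithful_module M \<longleftrightarrow> (\<forall>r. (\<forall>x\<in>carrier M. r \<odot>\<^bsub>M\<^esub> x = \<zero>\<^bsub>M\<^esub>) \<longrightarrow> r = 0)"

text \<open>
  A formula cannot quantify over the type of module elements.  The type \<open>'r set\<close> suffices, since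
  a simple module is isomorphic to one whose elements are cosets of a one-sided ideal: see
  \<open>left_primitiveI\<close> and \<open>right_primitiveI\<close> below.
\<close>

definition left_primitive :: "'r::ring itself \<Rightarrow> bool" where
  "left_primitive _ \<longleftrightarrow>
     (\<exists>M :: ('r, 'r set) module. left_ring_module M \<and> simple_module M \<and> faithful_module M)"

definition right_primitive :: "'r::ring itself \<Rightarrow> bool" where
  "right_primitive _ \<longleftrightarrow>
     (\<exists>M :: ('r, 'r set) module. right_ring_module M \<and> simple_module M \<and> faithful_module M)"

definition transport_module ::
  "('m \<Rightarrow> 'n) \<Rightarrow> ('r::ring, 'm) module \<Rightarrow> ('r, 'n) module" where
  "transport_module f M =
     (let g = inv_into (carrier M) f in
      \<lparr>carrier = f ` carrier M, mult = (\<lambda>X Y. f (g X)), one = f \<zero>\<^bsub>M\<^esub>, zero = f \<zero>\<^bsub>M\<^esub>,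
       add = (\<lambda>X Y. f (g X \<oplus>\<^bsub>M\<^esub> g Y)), smult = (\<lambda>r X. f (r \<odot>\<^bsub>M\<^esub> g X))\<rparr>)"

context additive_ring_action
begin

lemma smult_zero_right: "r \<odot> \<zero> = \<zero>"
  using smult_r_distr[of \<zero> \<zero> r] smult_closed[of \<zero> r]
  by (metis add.l_cancel_one' l_zero zero_closed)

lemma smult_zero_left: "x \<in> carrier M \<Longrightarrow> 0 \<odot> x = \<zero>"
  using smult_l_distr[of x 0 0] smult_closed[of x 0]
  by (metis add.l_cancel_one' add_0)

lemma smult_minus_left: "x \<in> carrier M \<Longrightarrow> (- r) \<odot> x = \<ominus> (r \<odot> x)"
  using smult_l_distr[of x "- r" r] smult_closed[of x] smult_zero_left[of x]
  by (metis add.left_inverse minus_equality)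

context
  fixes f :: "'m \<Rightarrow> 'n"
  assumes inj: "inj_on f (carrier M)"
begin

lemma transport_simps:
  "carrier (transport_module f M) = f ` carrier M"
  "\<zero>\<^bsub>transport_module f M\<^esub> = f \<zero>"
  "\<lbrakk>x \<in> carrier M; y \<in> carrier M\<rbrakk> \<Longrightarrow> f x \<oplus>\<^bsub>transport_module f M\<^esub> f y = f (x \<oplus> y)"
  "x \<in> carrier M \<Longrightarrow> r \<odot>\<^bsub>transport_module f M\<^esub> f x = f (r \<odot> x)"
  using inj by (simp_all add: transport_module_def Let_def)

lemma transport_action: "additive_ring_action (transport_module f M)"
proof -
  have "abelian_group (transport_module f M)"
  proof (rule abelian_groupI)
    fix X assume "X \<in> carrier (transport_module f M)"
    then obtain x where x: "x \<in> carrier M" "X = f x"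
      by (auto simp: transport_simps)
    then have "f (\<ominus> x) \<oplus>\<^bsub>transport_module f M\<^esub> X = \<zero>\<^bsub>transport_module f M\<^esub>"
      by (simp add: transport_simps l_neg)
    with x show "\<exists>Y\<in>carrier (transport_module f M).
        Y \<oplus>\<^bsub>transport_module f M\<^esub> X = \<zero>\<^bsub>transport_module f M\<^esub>"
      by (auto simp: transport_simps)
  qed (auto simp: transport_simps a_ac)
  moreover have "additive_ring_action_axioms (transport_module f M)"
    by unfold_locales
      (auto simp: transport_simps smult_closed smult_l_distr smult_r_distr)
  ultimately show ?thesis
    by (simp add: additive_ring_action_def)
qed

lemma transport_faithful:
  assumes "faithful_module M"
  shows "faithful_module (transport_module f M)"
  using assms inj
  by (auto simp: faithful_module_def transport_simps smult_closed inj_on_eq_iff)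

lemma transport_submodule:
  assumes "ring_submodule N (transport_module f M)"
  shows "ring_submodule {x \<in> carrier M. f x \<in> N} M"
proof -
  interpret T: additive_ring_action "transport_module f M"
    by (rule transport_action)
  interpret N: subgroup N "add_monoid (transport_module f M)"
    using assms by (simp add: ring_submodule_def)
  have "subgroup {x \<in> carrier M. f x \<in> N} (add_monoid M)"
  proof
    fix x assume "x \<in> {x \<in> carrier M. f x \<in> N}"
    then have x: "x \<in> carrier M" "f x \<in> N" by auto
    have "f (\<ominus> x) = \<ominus>\<^bsub>transport_module f M\<^esub> f x"
      by (rule T.minus_equality[symmetric])
        (use x in \<open>auto simp: transport_simps l_neg\<close>)
    moreover have "\<ominus>\<^bsub>transport_module f M\<^esub> f x \<in> N"
      using N.m_inv_closed[OF x(2)] by (simp add: a_inv_def)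
    ultimately show "inv\<^bsub>add_monoid M\<^esub> x \<in> {x \<in> carrier M. f x \<in> N}"
      using x by (simp add: a_inv_def[symmetric])
  next
    fix x y assume "x \<in> {x \<in> carrier M. f x \<in> N}" "y \<in> {x \<in> carrier M. f x \<in> N}"
    then show "x \<otimes>\<^bsub>add_monoid M\<^esub> y \<in> {x \<in> carrier M. f x \<in> N}"
      using N.m_closed[of "f x" "f y"] by (auto simp: transport_simps)
  qed (use N.one_closed in \<open>auto simp: transport_simps\<close>)
  with assms show ?thesis
    by (auto simp: ring_submodule_def smult_closed simp flip: transport_simps(4))
qed

lemma transport_simple:
  assumes "simple_module M"
  shows "simple_module (transport_module f M)"
  unfolding simple_module_def
proof (intro conjI allI impI)
  obtain r x where "x \<in> carrier M" "r \<odot> x \<noteq> \<zero>"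
    using assms by (auto simp: simple_module_def)
  then show "\<exists>r. \<exists>x\<in>carrier (transport_module f M).
      r \<odot>\<^bsub>transport_module f M\<^esub> x \<noteq> \<zero>\<^bsub>transport_module f M\<^esub>"
    using inj by (auto simp: transport_simps smult_closed inj_on_eq_iff intro!: exI[of _ r])
next
  fix N assume N: "ring_submodule N (transport_module f M)"
  then have sub: "N \<subseteq> f ` carrier M"
    using subgroup.subset[of N "add_monoid (transport_module f M)"]
    by (simp add: ring_submodule_def transport_simps)
  then have N_eq: "N = f ` {x \<in> carrier M. f x \<in> N}"
    by auto
  have "{x \<in> carrier M. f x \<in> N} = {\<zero>} \<or> {x \<in> carrier M. f x \<in> N} = carrier M"
    using transport_submodule[OF N] assms unfolding simple_module_def by blast
  then show "N = {\<zero>\<^bsub>transport_module f M\<^esub>} \<or> N = carrier (transport_module f M)"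
  proof
    assume "{x \<in> carrier M. f x \<in> N} = {\<zero>}"
    with N_eq show ?thesis by (simp add: transport_simps)
  next
    assume "{x \<in> carrier M. f x \<in> N} = carrier M"
    with N_eq show ?thesis by (simp only: transport_simps simp_thms)
  qed
qed

end

lemma cyclic_inj:
  assumes simple: "simple_module M"
    and sub: "\<And>x. x \<in> carrier M \<Longrightarrow> ring_submodule (range (\<lambda>s. s \<odot> x)) M"
  shows "\<exists>f :: 'm \<Rightarrow> 'r set. inj_on f (carrier M)"
proof -
  obtain r x where x: "x \<in> carrier M" "r \<odot> x \<noteq> \<zero>"
    using simple by (auto simp: simple_module_def)
  then have range: "range (\<lambda>s. s \<odot> x) = carrier M"
    using simple sub[OF x(1)] unfolding simple_module_def by blast
  have "inj_on (\<lambda>y. {s. s \<odot> x = y}) (carrier M)"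
  proof (rule inj_onI)
    fix y z assume y: "y \<in> carrier M" and eq: "{s. s \<odot> x = y} = {s. s \<odot> x = z}"
    from y have "y \<in> range (\<lambda>s. s \<odot> x)"
      by (simp add: range)
    then obtain s where s: "y = s \<odot> x"
      by (rule rangeE)
    then have "s \<in> {s. s \<odot> x = z}"
      unfolding eq[symmetric] by simp
    with s show "y = z"
      by simp
  qed
  then show ?thesis
    by blast
qed

lemma cyclic_subgroup:
  assumes "x \<in> carrier M"
  shows "subgroup (range (\<lambda>s. s \<odot> x)) (add_monoid M)"
proof
  show "\<one>\<^bsub>add_monoid M\<^esub> \<in> range (\<lambda>s. s \<odot> x)"
    using smult_zero_left[OF assms] by (auto intro: range_eqI[of _ _ 0])
next
  fix y assume "y \<in> range (\<lambda>s. s \<odot> x)"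
  then show "inv\<^bsub>add_monoid M\<^esub> y \<in> range (\<lambda>s. s \<odot> x)"
    using smult_minus_left[OF assms] by (auto simp: a_inv_def) (metis rangeI)
next
  fix y z assume "y \<in> range (\<lambda>s. s \<odot> x)" "z \<in> range (\<lambda>s. s \<odot> x)"
  then show "y \<otimes>\<^bsub>add_monoid M\<^esub> z \<in> range (\<lambda>s. s \<odot> x)"
    using smult_l_distr[OF assms] by auto (metis rangeI)
qed (use assms smult_closed in auto)

end

lemma left_primitiveI:
  fixes M :: "('r::ring, 'm) module"
  assumes "left_ring_module M" "simple_module M" "faithful_module M"
  shows "left_primitive TYPE('r)"
proof -
  interpret left_ring_module M by fact
  have "ring_submodule (range (\<lambda>s. s \<odot>\<^bsub>M\<^esub> x)) M" if "x \<in> carrier M" for x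
    using that cyclic_subgroup by (auto simp: ring_submodule_def simp flip: smult_assoc)
  then obtain f :: "'m \<Rightarrow> 'r set" where f: "inj_on f (carrier M)"
    using cyclic_inj assms(2) by blast
  interpret T: additive_ring_action "transport_module f M"
    using f by (rule transport_action)
  have "left_ring_module (transport_module f M)"
    using f by unfold_locales (auto simp: transport_simps smult_closed smult_assoc)
  then show ?thesis
    unfolding left_primitive_def
    using transport_simple[OF f assms(2)] transport_faithful[OF f assms(3)] by blast
qed

lemma right_primitiveI:
  fixes M :: "('r::ring, 'm) module"
  assumes "right_ring_module M" "simple_module M" "faithful_module M"
  shows "right_primitive TYPE('r)"
proof -
  interpret right_ring_module M by fact
  have "ring_submodule (range (\<lambda>s. s \<odot>\<^bsub>M\<^esub> x)) M" if "x \<in> carrier M" for x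
    using that cyclic_subgroup by (auto simp: ring_submodule_def simp flip: smult_assoc)
  then obtain f :: "'m \<Rightarrow> 'r set" where f: "inj_on f (carrier M)"
    using cyclic_inj assms(2) by blast
  interpret T: additive_ring_action "transport_module f M"
    using f by (rule transport_action)
  have "right_ring_module (transport_module f M)"
    using f by unfold_locales (auto simp: transport_simps smult_closed smult_assoc)
  then show ?thesis
    unfolding right_primitive_def
    using transport_simple[OF f assms(2)] transport_faithful[OF f assms(3)] by blast
qed

end

theory Submission
  imports Defs
begin

text \<open>
  Call an idempotent \<open>f \<noteq> 0\<close> a field idempotent if every nonzero element of the centre of \<open>fRf\<close>
  has \<open>f\<close> among its left multiples.  The proof has two halves.

  Separation.  There are nonzero idempotents \<open>f\<^sub>0 \<ge> f\<^sub>1 \<ge> \<dots>\<close>, meaning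
  \<open>f\<^sub>n\<^sub>+\<^sub>1 \<in> f\<^sub>n R f\<^sub>n\<close>, such that every nonzero ideal contains one of them
  (\<open>separating_chain\<close>).  By countable dimension, every nonzero ideal meets the span of one of
  countably many finite sets \<open>F\<close>, so it suffices to find below any given idempotent a single
  \<open>f \<noteq> 0\<close> contained in all ideals \<open>I\<close> that meet the span of \<open>F\<close> nontrivially
  (\<open>separating_idempotent\<close>).  Suppose that \<open>I\<close> contains \<open>x = \<Sum>\<^sub>s c\<^sub>s s \<noteq> 0\<close>.  The sub-bimodule \<open>W\<close> of
  \<open>R\<^sup>F\<close> generated by the tuple \<open>(s)\<^sub>s\<close> is mapped into \<open>I\<close> by the linear form with coefficients \<open>c\<close>.
  Gaussian elimination in \<open>W\<close> (\<open>central_tuples_detect\<close>) produces an \<open>f\<close>, depending on \<open>W\<close>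
  but not on \<open>c\<close> or \<open>I\<close>, for which a form that vanishes on all tuples of \<open>W\<close> with entries in the
  centre of \<open>fRf\<close> vanishes on all of \<open>fWf\<close>.  Since \<open>R\<close> is prime, the form is nonzero on \<open>fWf\<close>;
  so \<open>I\<close> contains a nonzero element of the centre of \<open>fRf\<close>, and hence \<open>f\<close>.  This elimination
  takes the place of linear algebra over the extended centroid of \<open>R\<close>: the pivots exist because
  a tuple of minimal support with entries in \<open>hRh\<close>, one of them the idempotent \<open>h\<close>, must commute
  with \<open>hRh\<close>.

  Primitivity.  The elements \<open>r\<close> with \<open>r f\<^sub>n = 0\<close> for some \<open>n\<close> form a left ideal that omits \<open>f\<^sub>0\<close>
  and contains every \<open>r - r f\<^sub>0\<close> and every \<open>f\<^sub>0 - f\<^sub>n\<close>.  Enlarge it to a left ideal \<open>L\<close> maximal among those omitting \<open>f\<^sub>0\<close>.  Then \<open>R/L\<close>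
  is simple, and it is faithful because a nonzero annihilator would contain some \<open>f\<^sub>n\<close>, forcing
  \<open>f\<^sub>0 \<in> L\<close> (\<open>simple_faithful_quotient\<close>).  The conditions on the chain are symmetric, so the same
  argument in the opposite ring gives right primitivity.
\<close>

section \<open>Prime rings and idempotents\<close>

lemma two_sided_idealI:
  assumes "0 \<in> A" "\<And>x y. x \<in> A \<Longrightarrow> y \<in> A \<Longrightarrow> x - y \<in> A"
    and "\<And>x r. x \<in> A \<Longrightarrow> r * x \<in> A" "\<And>x r. x \<in> A \<Longrightarrow> x * r \<in> A"
  shows "two_sided_ideal A"
proof -
  have neg: "- x \<in> A" if "x \<in> A" for x
    using assms(2)[OF assms(1) that] by simp
  have "x + y \<in> A" if "x \<in> A" "y \<in> A" for x y
    using assms(2)[OF that(1) neg[OF that(2)]] by simp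
  with neg assms show ?thesis
    by (simp add: two_sided_ideal_def right_ideal_def)
qed

lemma two_sided_idealD:
  assumes "two_sided_ideal A"
  shows "0 \<in> A" "x \<in> A \<Longrightarrow> y \<in> A \<Longrightarrow> x - y \<in> A" "x \<in> A \<Longrightarrow> r * x \<in> A" "x \<in> A \<Longrightarrow> x * r \<in> A"
  using assms unfolding two_sided_ideal_def right_ideal_def
  by (simp_all add: diff_conv_add_uminus del: add_uminus_conv_diff)

lemma prime_ring_ideals:
  fixes I J :: "'r::ring set"
  assumes "prime_ring TYPE('r)" "two_sided_ideal I" "two_sided_ideal J"
    and zero: "\<And>x y. x \<in> I \<Longrightarrow> y \<in> J \<Longrightarrow> x * y = 0"
  shows "I = {0} \<or> J = {0}"
proof (rule ccontr)
  assume "\<not> (I = {0} \<or> J = {0})"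
  then have "ideal_product I J \<noteq> {0}"
    using assms(1-3) by (auto simp: prime_ring_def)
  moreover have "z = 0" if "z \<in> ideal_product I J" for z
    using that by induction (simp_all add: zero)
  moreover have "0 \<in> ideal_product I J"
    using ideal_product.prod[of 0 I 0 J] assms(2,3)
    by (simp add: two_sided_ideal_def right_ideal_def)
  ultimately show False
    by blast
qed

text \<open>
  If \<open>a R b = 0\<close>, then \<open>aR\<close> annihilates the ideal \<open>J\<close> of all \<open>y\<close> with \<open>a R y = 0\<close>, which contains
  \<open>b\<close>.  Primeness then kills \<open>aR\<close>, and in the absence of a unit it has to be used once more, to
  kill \<open>a\<close>.
\<close>

lemma prime_ring_elements:
  fixes a b :: "'r::ring"
  assumes prime: "prime_ring TYPE('r)" and "a \<noteq> 0" "b \<noteq> 0"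
  shows "\<exists>x. a * x * b \<noteq> 0"
proof (rule ccontr)
  assume no: "\<nexists>x. a * x * b \<noteq> 0"
  define J where "J = {y. \<forall>r. a * r * y = 0}"
  define I where "I = {x. \<forall>y\<in>J. x * y = 0}"
  define A where "A = {x :: 'r. \<forall>r. x * r = 0}"
  have J: "two_sided_ideal J"
  proof (rule two_sided_idealI)
    fix y r assume y: "y \<in> J"
    have "a * s * (r * y) = 0" for s
      using y[unfolded J_def, simplified, THEN spec, of "s * r"] by (simp add: mult.assoc)
    then show "r * y \<in> J"
      by (simp add: J_def)
  qed (auto simp: J_def right_diff_distrib simp flip: mult.assoc)
  have I: "two_sided_ideal I"
    using J unfolding two_sided_ideal_def right_ideal_def I_def
    by (auto simp: distrib_right mult.assoc)
  have A: "two_sided_ideal A"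
    unfolding two_sided_ideal_def right_ideal_def A_def
    by (auto simp: distrib_right mult.assoc)
  have U: "two_sided_ideal (UNIV :: 'r set)"
    by (simp add: two_sided_ideal_def right_ideal_def)
  have "b \<in> J"
    using no by (simp add: J_def)
  then have "J \<noteq> {0}" "(UNIV :: 'r set) \<noteq> {0}"
    using \<open>b \<noteq> 0\<close> by auto
  then have "I = {0}" "A = {0}"
    using prime_ring_ideals[OF prime I J] prime_ring_ideals[OF prime A U]
    by (auto simp: I_def A_def)
  moreover have "a * r \<in> I" for r
    by (simp add: I_def J_def)
  ultimately have "a \<in> A"
    by (auto simp: A_def)
  with \<open>A = {0}\<close> \<open>a \<noteq> 0\<close> show False
    by simp
qed

definition field_idempotent :: "'r::ring \<Rightarrow> bool" where
  "field_idempotent f \<longleftrightarrow> f * f = f \<and> f \<noteq> 0 \<and>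
     (\<forall>z\<in>center (corner f). z \<noteq> 0 \<longrightarrow> (\<exists>y. y * z = f))"

lemma field_idempotentI:
  assumes "field (corner_center e)" "e * e = e" "e \<noteq> 0"
  shows "field_idempotent e"
proof -
  interpret field "corner_center e" by fact
  have "\<exists>y. y * z = e" if "z \<in> center (corner e)" "z \<noteq> 0" for z
  proof -
    have "z \<in> Units (corner_center e)"
      using that field_Units by (simp add: corner_center_def)
    then show ?thesis
      by (auto simp: Units_def corner_center_def)
  qed
  with assms show ?thesis
    by (simp add: field_idempotent_def)
qed

text \<open>Membership in the corner as equations linear in \<open>z\<close>, which pass to linear combinations.\<close>

lemma center_corner_iff:
  assumes "f * f = f"
  shows "z \<in> center (corner f) \<longleftrightarrow>
    f * z = z \<and> z * f = z \<and> (\<forall>r. z * (f * r * f) = f * r * f * z)"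
proof -
  have "z \<in> corner f \<longleftrightarrow> f * z = z \<and> z * f = z"
    using assms unfolding corner_def by (auto simp: mult.assoc) (metis mult.assoc)+
  then show ?thesis
    by (auto simp: center_def corner_def)
qed

text \<open>
  When \<open>gh = h\<close>, the idempotents \<open>h\<close> and \<open>hg\<close> generate the same right ideal, and \<open>z \<mapsto> zh\<close> is an
  isomorphism of the corner of \<open>hg\<close> onto the corner of \<open>h\<close>.  This trades an idempotent of the right
  ideal \<open>gR\<close> for one of the corner \<open>gRg\<close>.
\<close>

lemma field_idempotent_swap:
  fixes g h :: "'r::ring"
  assumes h: "field_idempotent h" and gh: "g * h = h"
  shows "field_idempotent (h * g)"
proof -
  have hh: "h * h = h" and "h \<noteq> 0"
    using h by (auto simp: field_idempotent_def)
  have simps: "h * (h * x) = h * x" "g * (h * x) = h * x" for x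
    by (simp_all add: hh gh flip: mult.assoc)
  have hghg: "(h * g) * (h * g) = h * g"
    by (simp add: mult.assoc simps)
  have "h * g \<noteq> 0"
    using hh gh \<open>h \<noteq> 0\<close> by (metis mult.assoc mult_zero_left)
  moreover have "\<exists>y. y * z = h * g" if z: "z \<in> center (corner (h * g))" "z \<noteq> 0" for z
  proof -
    have z1: "h * (g * z) = z" and z2: "z * (h * g) = z"
      and z3: "\<And>r. z * (h * g * r * (h * g)) = h * g * r * (h * g) * z"
      using z(1) center_corner_iff[OF hghg] by (auto simp: mult.assoc)
    have hz: "h * z = z" "g * z = z"
      by (metis z1 simps)+
    then have hzx: "h * (z * x) = z * x" "g * (z * x) = z * x" for x
      by (simp_all flip: mult.assoc)
    have "z * h \<in> center (corner h)"
      unfolding center_corner_iff[OF hh]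
    proof (intro conjI allI)
      show "h * (z * h) = z * h" "z * h * h = z * h"
        by (simp add: hz flip: mult.assoc) (simp add: hh mult.assoc)
      fix r
      have "z * (h * r * (h * g)) = h * r * (h * g) * z"
        using z3[of "h * r"] by (simp add: mult.assoc simps)
      then have "z * (h * r * (h * g)) * h = h * r * (h * g) * z * h"
        by simp
      then show "z * h * (h * r * h) = h * r * h * (z * h)"
        by (simp add: mult.assoc simps hh gh hzx)
    qed
    moreover have "z * h \<noteq> 0"
      using z2 z(2) by (metis mult.assoc mult_zero_left)
    ultimately obtain y where "y * (z * h) = h"
      using h by (auto simp: field_idempotent_def)
    then have "y * z = h * g"
      using z2 by (metis mult.assoc)
    then show ?thesis ..
  qed
  ultimately show ?thesis
    using hghg by (simp add: field_idempotent_def)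
qed

locale field_idempotent_algebra = nonunital_algebra scale
  for scale :: "'k::field \<Rightarrow> 'r::ring \<Rightarrow> 'r" +
  assumes prime: "\<And>a b :: 'r. a \<noteq> 0 \<Longrightarrow> b \<noteq> 0 \<Longrightarrow> \<exists>x. a * x * b \<noteq> 0"
    and right_ideal_idempotent: "\<And>I :: 'r set. right_ideal I \<Longrightarrow> I \<noteq> {0} \<Longrightarrow>
      \<exists>e\<in>I. field_idempotent e"
begin

lemma ideal_idempotent_below:
  fixes A :: "'r set"
  assumes A: "two_sided_ideal A" "A \<noteq> {0}" and g: "g * g = g" "g \<noteq> 0"
  shows "\<exists>f\<in>A. field_idempotent f \<and> g * f = f \<and> f * g = f"
proof -
  obtain a where a: "a \<in> A" "a \<noteq> 0"
    using A by (auto simp: two_sided_ideal_def right_ideal_def)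
  obtain x where x: "g * x * a \<noteq> 0"
    using prime[OF g(2) a(2)] by blast
  have J: "right_ideal ((*) g ` A)"
    using A(1) unfolding two_sided_ideal_def right_ideal_def
    by (auto simp: mult.assoc image_iff simp flip: distrib_left)
      (metis mult_zero_right, metis mult_minus_right)
  have "x * a \<in> A"
    using A(1) a(1) by (simp add: two_sided_ideal_def)
  then have "(*) g ` A \<noteq> {0}"
    using x by (metis image_eqI mult.assoc singletonD)
  then obtain h where h: "h \<in> (*) g ` A" "field_idempotent h"
    using right_ideal_idempotent[OF J] by blast
  then have "h \<in> A" and gh: "g * h = h"
    using A(1) g(1) by (auto simp: two_sided_ideal_def simp flip: mult.assoc)
  then have "h * g \<in> A"
    using A(1) by (simp add: two_sided_ideal_def right_ideal_def)
  moreover have "g * (h * g) = h * g" "h * g * g = h * g"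
    using gh g(1) by (simp flip: mult.assoc) (simp add: mult.assoc g(1))
  ultimately show ?thesis
    using field_idempotent_swap[OF h(2) gh] by blast
qed

end

section \<open>Elimination in bimodules of tuples\<close>

text \<open>
  Tuples are total functions on an index type; the lemmas below look only at the entries in a
  finite set \<open>F\<close> of indices.
\<close>

definition tuple_subbimodule :: "('i \<Rightarrow> 'r::ring) set \<Rightarrow> bool" where
  "tuple_subbimodule W \<longleftrightarrow> (\<lambda>_. 0) \<in> W \<and>
     (\<forall>u\<in>W. \<forall>v\<in>W. (\<lambda>i. u i - v i) \<in> W) \<and>
     (\<forall>u\<in>W. \<forall>r. (\<lambda>i. r * u i) \<in> W \<and> (\<lambda>i. u i * r) \<in> W)"

lemma tuple_subbimoduleD:
  assumes "tuple_subbimodule W"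
  shows "(\<lambda>_. 0) \<in> W"
    and "u \<in> W \<Longrightarrow> v \<in> W \<Longrightarrow> (\<lambda>i. u i - v i) \<in> W"
    and "u \<in> W \<Longrightarrow> (\<lambda>i. r * u i) \<in> W"
    and "u \<in> W \<Longrightarrow> (\<lambda>i. u i * r) \<in> W"
  using assms by (auto simp: tuple_subbimodule_def)

context field_idempotent_algebra
begin

text \<open>
  The pivot step.  Let \<open>v\<close> have minimal nonempty support and let \<open>p\<close> be in it.  The \<open>p\<close>-entries of
  the tuples supported inside the support of \<open>v\<close> form a nonzero ideal, so some \<open>u\<close> has an idempotent
  \<open>h\<close> as its \<open>p\<close>-entry, and one may take all its entries in \<open>hRh\<close>.  For \<open>x \<in> hRh\<close> the tuple
  \<open>ux - xu\<close> vanishes at \<open>p\<close>, hence everywhere by minimality: the entries of \<open>u\<close> are central in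
  \<open>hRh\<close>.
\<close>

lemma minimal_support_central_tuple:
  fixes W :: "('i \<Rightarrow> 'r) set"
  assumes W: "tuple_subbimodule W" and F: "finite F"
    and w: "w \<in> W" "i \<in> F" "w i \<noteq> 0" and g: "g * g = g" "g \<noteq> 0"
  shows "\<exists>h u p. field_idempotent h \<and> g * h = h \<and> h * g = h \<and> u \<in> W \<and> p \<in> F \<and> u p = h \<and>
    (\<forall>i\<in>F. u i \<in> center (corner h))"
proof -
  define supp where "supp = (\<lambda>v :: 'i \<Rightarrow> 'r. {i \<in> F. v i \<noteq> 0})"
  have "w \<in> W \<and> supp w \<noteq> {}"
    using w by (auto simp: supp_def)
  from ex_has_least_nat[where m = "\<lambda>v. card (supp v)" and P = "\<lambda>v. v \<in> W \<and> supp v \<noteq> {}", OF this]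
  obtain v where v: "v \<in> W" "supp v \<noteq> {}"
    and minimal: "\<And>u. u \<in> W \<Longrightarrow> supp u \<noteq> {} \<Longrightarrow> card (supp v) \<le> card (supp u)"
    by blast
  then obtain p where p: "p \<in> F" "v p \<noteq> 0"
    by (auto simp: supp_def)
  define U where "U = {u \<in> W. supp u \<subseteq> supp v}"
  have U: "tuple_subbimodule U"
    unfolding tuple_subbimodule_def
  proof (intro conjI ballI allI)
    show "(\<lambda>_. 0) \<in> U"
      using tuple_subbimoduleD(1)[OF W] by (simp add: U_def supp_def)
    fix s assume s: "s \<in> U"
    have s0: "s i = 0" if "v i = 0" "i \<in> F" for i
      using s that by (auto simp: U_def supp_def)
    show "(\<lambda>i. r * s i) \<in> U" "(\<lambda>i. s i * r) \<in> U" for r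
      using s s0 tuple_subbimoduleD(3,4)[OF W] by (auto simp: U_def supp_def)
    fix t assume t: "t \<in> U"
    have "t i = 0" if "v i = 0" "i \<in> F" for i
      using t that by (auto simp: U_def supp_def)
    then show "(\<lambda>i. s i - t i) \<in> U"
      using s t s0 tuple_subbimoduleD(2)[OF W] by (auto simp: U_def supp_def)
  qed
  have "two_sided_ideal ((\<lambda>u. u p) ` U)"
    using tuple_subbimoduleD[OF U] by (intro two_sided_idealI) (blast intro: rev_image_eqI)+
  moreover have "(\<lambda>u. u p) ` U \<noteq> {0}"
    using p v by (auto simp: U_def)
  ultimately obtain u0 where h: "field_idempotent (u0 p)" "g * u0 p = u0 p" "u0 p * g = u0 p"
    and u0: "u0 \<in> U"
    using ideal_idempotent_below[OF _ _ g] by blast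
  define h where "h = u0 p"
  define u where "u = (\<lambda>i. h * u0 i * h)"
  have hh: "h * h = h"
    using h by (simp add: field_idempotent_def h_def)
  have u: "u \<in> U"
    unfolding u_def using tuple_subbimoduleD[OF U] u0 by blast
  have up: "u p = h"
    by (simp add: u_def hh flip: h_def)
  have "u i \<in> center (corner h)" if i: "i \<in> F" for i
    unfolding center_corner_iff[OF hh]
  proof (intro conjI allI)
    show "h * u i = u i" "u i * h = u i"
      by (simp_all add: u_def hh mult.assoc) (simp_all add: hh flip: mult.assoc)
    fix r
    define d where "d = (\<lambda>i. u i * (h * r * h) - h * r * h * u i)"
    have d: "d \<in> U"
      unfolding d_def using tuple_subbimoduleD[OF U] u by blast
    have "d p = 0"
      by (simp add: d_def up hh mult.assoc) (simp add: hh flip: mult.assoc)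
    then have "supp d \<subseteq> supp v - {p}"
      using d by (auto simp: U_def supp_def)
    then have "supp d \<subset> supp v"
      using p by (auto simp: supp_def)
    then have "card (supp d) < card (supp v)"
      using F by (intro psubset_card_mono) (auto simp: supp_def)
    then have "supp d = {}"
      using minimal[of d] d by (auto simp: U_def)
    then show "u i * (h * r * h) = h * r * h * u i"
      using i by (auto simp: supp_def d_def)
  qed
  then show ?thesis
    using h up u p(1) by (auto simp: U_def h_def)
qed

text \<open>Central elements stay central in a smaller corner, so pivots survive the passage to it.\<close>

lemma central_tuple_restrict:
  fixes h f z :: 'r
  assumes h: "h * h = h" and f: "f * f = f" "h * f = f" "f * h = f"
    and z: "z \<in> center (corner h)"
  shows "f * z \<in> center (corner f)" "z * f = f * z"
proof -
  have "h * f * h = f"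
    using f by simp
  then show zf: "z * f = f * z"
    using z center_corner_iff[OF h, of z] by metis
  have z2: "z * (h * r * h) = h * r * h * z" for r
    using z center_corner_iff[OF h, of z] by blast
  show "f * z \<in> center (corner f)"
    unfolding center_corner_iff[OF f(1)]
  proof (intro conjI allI)
    show "f * (f * z) = f * z"
      by (simp add: f flip: mult.assoc)
    then show "f * z * f = f * z"
      by (simp add: mult.assoc zf)
    fix r
    have "h * (f * r * f) * h = f * r * f"
      using f by (simp add: mult.assoc) (simp flip: mult.assoc add: f)
    then have "z * (f * r * f) = f * r * f * z"
      using z2 by metis
    then show "f * z * (f * r * f) = f * r * f * (f * z)"
      by (metis f(1) mult.assoc zf)
  qed
qed

text \<open>
  Gaussian elimination.  Given a pivot tuple \<open>u\<close> with \<open>u p = h\<close> and entries central in \<open>hRh\<close>, the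
  induction hypothesis for the tuples vanishing at \<open>p\<close> yields \<open>f \<in> hRh\<close>.  The tuple \<open>f u\<close> is central
  for \<open>f\<close> with \<open>p\<close>-entry \<open>f\<close>, and subtracting a left multiple of it from \<open>f w f\<close> clears the entry
  at \<open>p\<close>.  The idempotent is chosen before the form \<open>c\<close>, so one \<open>f\<close> serves all linear
  combinations at once.
\<close>

lemma central_tuples_detect:
  fixes W :: "('i \<Rightarrow> 'r) set"
  assumes "finite F" "tuple_subbimodule W" "g * g = g" "g \<noteq> 0"
  shows "\<exists>f. field_idempotent f \<and> g * f = f \<and> f * g = f \<and>
    (\<forall>c. (\<forall>u\<in>W. (\<forall>i\<in>F. u i \<in> center (corner f)) \<longrightarrow> (\<Sum>i\<in>F. scale (c i) (u i)) = 0) \<longrightarrow>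
      (\<forall>w\<in>W. (\<Sum>i\<in>F. scale (c i) (f * w i * f)) = 0))"
  using assms
proof (induction F arbitrary: W g rule: finite_psubset_induct)
  case (psubset F)
  note W = tuple_subbimoduleD[OF psubset.prems(1)]
  show ?case
  proof (cases "\<forall>w\<in>W. \<forall>i\<in>F. w i = 0")
    case True
    have "two_sided_ideal (UNIV :: 'r set)" "(UNIV :: 'r set) \<noteq> {0}"
      using psubset.prems by (auto intro: two_sided_idealI)
    then obtain f where "field_idempotent f" "g * f = f" "f * g = f"
      using ideal_idempotent_below psubset.prems by blast
    with True show ?thesis
      by (intro exI[of _ f]) (auto intro!: sum.neutral)
  next
    case False
    then obtain h u p where h: "field_idempotent h" "g * h = h" "h * g = h"
      and u: "u \<in> W" "u p = h" "\<And>i. i \<in> F \<Longrightarrow> u i \<in> center (corner h)" and p: "p \<in> F"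
      using minimal_support_central_tuple[OF psubset.prems(1) psubset.hyps(1) _ _ _ psubset.prems(2,3)]
      by blast
    define V where "V = {w \<in> W. w p = 0}"
    have V: "tuple_subbimodule V"
      using psubset.prems(1) by (auto simp: tuple_subbimodule_def V_def)
    have hh: "h * h = h" "h \<noteq> 0"
      using h by (auto simp: field_idempotent_def)
    have "F - {p} \<subset> F"
      using p by auto
    from psubset.IH[OF this V hh] obtain f where f: "field_idempotent f" "h * f = f" "f * h = f"
      and IH_all: "\<forall>c. (\<forall>u\<in>V. (\<forall>i\<in>F - {p}. u i \<in> center (corner f)) \<longrightarrow>
                   (\<Sum>i\<in>F - {p}. scale (c i) (u i)) = 0) \<longrightarrow>
        (\<forall>w\<in>V. (\<Sum>i\<in>F - {p}. scale (c i) (f * w i * f)) = 0)"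
      by blast
    have IH: "(\<Sum>i\<in>F - {p}. scale (c i) (f * w i * f)) = 0"
      if "\<And>u. u \<in> V \<Longrightarrow> (\<And>i. i \<in> F - {p} \<Longrightarrow> u i \<in> center (corner f)) \<Longrightarrow>
            (\<Sum>i\<in>F - {p}. scale (c i) (u i)) = 0" "w \<in> V" for c w
      using IH_all that by blast
    have ff: "f * f = f"
      using f by (simp add: field_idempotent_def)
    have split: "(\<Sum>i\<in>F. scale (c i) (w i)) = (\<Sum>i\<in>F - {p}. scale (c i) (w i))"
      if "w p = 0" for c and w :: "'i \<Rightarrow> 'r"
      using that psubset.hyps(1) p by (simp add: sum.remove)
    have "(\<Sum>i\<in>F. scale (c i) (f * w i * f)) = 0"
      if c: "\<And>u. u \<in> W \<Longrightarrow> (\<And>i. i \<in> F \<Longrightarrow> u i \<in> center (corner f)) \<Longrightarrow>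
                   (\<Sum>i\<in>F. scale (c i) (u i)) = 0"
        and w: "w \<in> W" for c w
    proof -
      define a where "a = f * w p * f"
      define v where "v = (\<lambda>i. f * w i * f - a * u i)"
      have "v \<in> W"
        unfolding v_def using W w u(1) by blast
      moreover have vp: "v p = 0"
        by (simp add: v_def u(2) a_def mult.assoc f)
      ultimately have "v \<in> V"
        by (simp add: V_def)
      \<comment> \<open>A central tuple of \<open>V\<close> for the indices \<open>F - {p}\<close> is central on \<open>F\<close>, having entry \<open>0\<close> at \<open>p\<close>.\<close>
      have v0: "(\<Sum>i\<in>F - {p}. scale (c i) (f * v i * f)) = 0"
      proof (rule IH[OF _ \<open>v \<in> V\<close>])
        fix t assume t: "t \<in> V" "\<And>i. i \<in> F - {p} \<Longrightarrow> t i \<in> center (corner f)"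
        have "t i \<in> center (corner f)" if "i \<in> F" for i
          using t that by (cases "i = p") (auto simp: V_def center_corner_iff[OF ff])
        then show "(\<Sum>i\<in>F - {p}. scale (c i) (t i)) = 0"
          using c[of t] t(1) split[of t c] by (simp add: V_def)
      qed
      have u0: "(\<Sum>i\<in>F. scale (c i) (f * u i)) = 0"
        using c[of "\<lambda>i. f * u i"] W(3)[OF u(1)] central_tuple_restrict(1)[OF hh(1) ff f(2,3)] u(3)
        by blast
      have "(\<Sum>i\<in>F. scale (c i) (f * w i * f)) =
          (\<Sum>i\<in>F. scale (c i) (f * v i * f) + a * scale (c i) (f * u i))"
      proof (rule sum.cong)
        fix i assume i: "i \<in> F"
        have "f * v i * f = f * w i * f - a * (f * u i)"
          using central_tuple_restrict(2)[OF hh(1) ff f(2,3) u(3)[OF i]] ff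
          unfolding v_def a_def
          by (simp add: right_diff_distrib left_diff_distrib mult.assoc)
            (simp add: right_diff_distrib left_diff_distrib ff flip: mult.assoc)
        then have "f * w i * f = f * v i * f + a * (f * u i)"
          by simp
        then show "scale (c i) (f * w i * f) = scale (c i) (f * v i * f) + a * scale (c i) (f * u i)"
          by (simp add: scale_right_distrib scale_mult_right)
      qed simp
      also have "\<dots> = (\<Sum>i\<in>F. scale (c i) (f * v i * f)) + a * (\<Sum>i\<in>F. scale (c i) (f * u i))"
        by (simp add: sum.distrib sum_distrib_left)
      also have "\<dots> = 0"
        using v0 u0 split[of "\<lambda>i. f * v i * f" c] vp by simp
      finally show ?thesis .
    qed
    moreover have "g * f = f" "f * g = f"
      using f h by (metis mult.assoc)+
    ultimately show ?thesis
      using f(1) by (intro exI[of _ f]) blast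
  qed
qed

inductive_set generated_tuples :: "('i \<Rightarrow> 'r) \<Rightarrow> ('i \<Rightarrow> 'r) set" for s where
  base: "s \<in> generated_tuples s"
| diff: "u \<in> generated_tuples s \<Longrightarrow> v \<in> generated_tuples s \<Longrightarrow>
    (\<lambda>i. u i - v i) \<in> generated_tuples s"
| left: "u \<in> generated_tuples s \<Longrightarrow> (\<lambda>i. r * u i) \<in> generated_tuples s"
| right: "u \<in> generated_tuples s \<Longrightarrow> (\<lambda>i. u i * r) \<in> generated_tuples s"

lemma generated_tuples_subbimodule: "tuple_subbimodule (generated_tuples s)"
  using generated_tuples.diff[OF generated_tuples.base generated_tuples.base, of s]
  by (auto simp: tuple_subbimodule_def intro: generated_tuples.intros)

text \<open>
  Indexing tuples by the elements of \<open>F\<close> themselves, the tuple to start from is the identity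
  function.  The form with coefficients \<open>c\<close> sends it to \<open>x = \<Sum>\<^sub>i c\<^sub>i i \<in> I\<close> and therefore sends the
  whole bimodule it generates into \<open>I\<close>, including a nonzero central element of \<open>fRf\<close>; the field
  property of \<open>f\<close> then puts \<open>f\<close> itself into \<open>I\<close>.
\<close>

lemma separating_idempotent:
  assumes F: "finite F" and g: "g * g = g" "g \<noteq> 0"
  shows "\<exists>f. field_idempotent f \<and> g * f = f \<and> f * g = f \<and>
    (\<forall>I. two_sided_ideal I \<longrightarrow> \<not> I \<inter> span F \<subseteq> {0} \<longrightarrow> f \<in> I)"
proof -
  let ?W = "generated_tuples (\<lambda>x :: 'r. x)"
  obtain f where f: "field_idempotent f" "g * f = f" "f * g = f"
    and D: "\<forall>c. (\<forall>u\<in>?W. (\<forall>i\<in>F. u i \<in> center (corner f)) \<longrightarrow> (\<Sum>i\<in>F. scale (c i) (u i)) = 0) \<longrightarrow>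
      (\<forall>w\<in>?W. (\<Sum>i\<in>F. scale (c i) (f * w i * f)) = 0)"
    using central_tuples_detect[OF F generated_tuples_subbimodule g, of "\<lambda>x. x"] by blast
  then have detect: "\<exists>u\<in>?W. (\<forall>i\<in>F. u i \<in> center (corner f)) \<and> (\<Sum>i\<in>F. scale (c i) (u i)) \<noteq> 0"
    if "w \<in> ?W" "(\<Sum>i\<in>F. scale (c i) (f * w i * f)) \<noteq> 0" for c w
    using that by blast
  have ff: "f * f = f" "f \<noteq> 0"
    using f by (auto simp: field_idempotent_def)
  have "f \<in> I" if I: "two_sided_ideal I" and meets: "\<not> I \<inter> span F \<subseteq> {0}" for I
  proof -
    obtain x where x: "x \<in> I" "x \<in> span F" "x \<noteq> 0"
      using meets by blast
    then obtain c where c: "x = (\<Sum>i\<in>F. scale (c i) i)"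
      using span_finite[OF F] by auto
    have in_I: "(\<Sum>i\<in>F. scale (c i) (w i)) \<in> I" if "w \<in> ?W" for w
      using that
    proof induction
      case base
      then show ?case using x c by simp
    next
      case (diff u v)
      then show ?case
        using two_sided_idealD[OF I] by (simp add: scale_right_diff_distrib sum_subtractf)
    next
      case (left u r)
      then show ?case
        using two_sided_idealD(3)[OF I left.IH, of r]
        by (simp add: sum_distrib_left scale_mult_right)
    next
      case (right u r)
      then show ?case
        using two_sided_idealD(4)[OF I right.IH, of r]
        by (simp add: sum_distrib_right scale_mult_left)
    qed
    \<comment> \<open>The form does not vanish on \<open>fWf\<close>, because \<open>f R x R f \<noteq> 0\<close> by primeness.\<close>
    obtain a where "f * a * x \<noteq> 0"
      using prime[OF ff(2) x(3)] by blast
    then obtain b where b: "f * a * x * b * f \<noteq> 0"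
      using prime[OF _ ff(2)] by blast
    have "(\<Sum>i\<in>F. scale (c i) (f * (a * (i * b)) * f)) = f * a * x * b * f"
      by (simp add: c sum_distrib_left sum_distrib_right scale_mult_right scale_mult_left mult.assoc)
    moreover have "(\<lambda>i. a * (i * b)) \<in> ?W"
      by (intro generated_tuples.intros)
    ultimately obtain u where u: "u \<in> ?W" "\<forall>i\<in>F. u i \<in> center (corner f)"
      and nz: "(\<Sum>i\<in>F. scale (c i) (u i)) \<noteq> 0"
      using detect[of "\<lambda>i. a * (i * b)" c] b by auto
    let ?z = "\<Sum>i\<in>F. scale (c i) (u i)"
    have "?z \<in> center (corner f)"
      using u(2) unfolding center_corner_iff[OF ff(1)]
      by (simp add: sum_distrib_left sum_distrib_right scale_mult_left scale_mult_right)
    then obtain y where "y * ?z = f"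
      using f(1) nz by (auto simp: field_idempotent_def)
    then show "f \<in> I"
      using two_sided_idealD(3)[OF I in_I[OF u(1)], of y] by simp
  qed
  with f show ?thesis
    by blast
qed

text \<open>
  The finite subsets of a countable basis are countable in number, and every element lies in the
  span of one of them.  Treat them in turn, choosing each idempotent in the corner of its
  predecessor.
\<close>

lemma separating_chain:
  assumes "countable_dimension" and nontrivial: "\<exists>x :: 'r. x \<noteq> 0"
  shows "\<exists>f :: nat \<Rightarrow> 'r. (\<forall>n. f n \<noteq> 0) \<and> (\<forall>m n. m \<le> n \<longrightarrow> f m * f n = f n \<and> f n * f m = f n) \<and>
    (\<forall>I. two_sided_ideal I \<longrightarrow> I \<noteq> {0} \<longrightarrow> (\<exists>n. f n \<in> I))"
proof -
  obtain B where B: "span B = UNIV" "countable B"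
    using assms(1) by (auto simp: countable_dimension_def)
  define \<F> where "\<F> = {F. finite F \<and> F \<subseteq> B}"
  have \<F>: "countable \<F>" "\<F> \<noteq> {}"
    using countable_Collect_finite_subset[OF B(2)] by (auto simp: \<F>_def)
  define F where "F = from_nat_into \<F>"
  have finite: "finite (F n)" for n
    using from_nat_into[OF \<F>(2), of n] by (simp add: \<F>_def F_def)
  have U: "two_sided_ideal (UNIV :: 'r set)" "(UNIV :: 'r set) \<noteq> {0}"
    using nontrivial by (auto intro: two_sided_idealI)
  then obtain e :: 'r where e: "field_idempotent e"
    using right_ideal_idempotent by (meson two_sided_ideal_def)
  define separates where "separates = (\<lambda>n f. \<forall>I. two_sided_ideal I \<longrightarrow> \<not> I \<inter> span (F n) \<subseteq> {0} \<longrightarrow> f \<in> I)"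
  have "\<exists>f. \<forall>n. field_idempotent (f n) \<and>
      (f n * f (Suc n) = f (Suc n) \<and> f (Suc n) * f n = f (Suc n) \<and> separates n (f (Suc n)))"
  proof (rule dependent_nat_choice)
    fix g :: 'r and n assume "field_idempotent g"
    then show "\<exists>f. field_idempotent f \<and> (g * f = f \<and> f * g = f \<and> separates n f)"
      using separating_idempotent[OF finite, of g n]
      by (auto simp: field_idempotent_def separates_def)
  qed (use e in auto)
  then obtain f where f: "\<And>n. field_idempotent (f n)"
    and below: "\<And>n. f n * f (Suc n) = f (Suc n)" "\<And>n. f (Suc n) * f n = f (Suc n)"
    and sep: "\<And>n. separates n (f (Suc n))"
    by blast
  have ff: "f n * f n = f n" "f n \<noteq> 0" for n
    using f by (auto simp: field_idempotent_def)
  have "f m * f n = f n \<and> f n * f m = f n" if "m \<le> n" for m n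
    using that
  proof (induction rule: dec_induct)
    case (step n)
    then show ?case
      using below by (metis mult.assoc)
  qed (simp add: ff)
  moreover have "\<exists>n. f n \<in> I" if I: "two_sided_ideal I" "I \<noteq> {0}" for I
  proof -
    obtain x where x: "x \<in> I" "x \<noteq> 0"
      using I two_sided_idealD(1)[OF I(1)] by blast
    have "x \<in> span B"
      by (simp add: B)
    then obtain t c where t: "finite t" "t \<subseteq> B" "x = (\<Sum>a\<in>t. scale (c a) a)"
      unfolding span_explicit by blast
    then have "x \<in> span t"
      by (auto intro: span_sum span_scale span_base)
    moreover obtain n where "F n = t"
      using t from_nat_into_surj[OF \<F>(1), of t] by (auto simp: \<F>_def F_def)
    ultimately show ?thesis
      using sep[of n] x I(1) by (auto simp: separates_def)
  qed
  ultimately show ?thesis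
    using ff by blast
qed

end

section \<open>Simple quotients\<close>

text \<open>
  The multiplication is a parameter, so that the same construction applies to the ring and to its
  opposite, which share one type and one addition.
\<close>

locale ring_multiplication =
  fixes m :: "'r::ring \<Rightarrow> 'r \<Rightarrow> 'r"
  assumes m_assoc: "m (m x y) z = m x (m y z)"
    and m_add_left: "m (x + y) z = m x z + m y z"
    and m_add_right: "m x (y + z) = m x y + m x z"
begin

lemma m_zero: "m 0 x = 0" "m x 0 = 0"
  using m_add_left[of 0 0 x] m_add_right[of x 0 0] by simp_all

lemma m_diff: "m (x - y) z = m x z - m y z" "m x (y - z) = m x y - m x z"
  using m_add_left[of "x - y" y z] m_add_right[of x "y - z" z] by (simp_all add: algebra_simps)

definition left_ideal :: "'r set \<Rightarrow> bool" where
  "left_ideal L \<longleftrightarrow> 0 \<in> L \<and> (\<forall>x\<in>L. \<forall>y\<in>L. x - y \<in> L) \<and> (\<forall>x\<in>L. \<forall>r. m r x \<in> L)"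

definition coset :: "'r set \<Rightarrow> 'r \<Rightarrow> 'r set" where
  "coset L a = {x. x - a \<in> L}"

text \<open>
  The operations pick representatives; \<open>quotient_simps\<close> shows that the choice does not
  matter.
\<close>

definition quotient_module :: "'r set \<Rightarrow> ('r, 'r set) module" where
  "quotient_module L =
     \<lparr>carrier = range (coset L), mult = (\<lambda>X Y. X), one = coset L 0, zero = coset L 0,
      add = (\<lambda>X Y. coset L ((SOME a. a \<in> X) + (SOME b. b \<in> Y))),
      smult = (\<lambda>r X. coset L (m r (SOME a. a \<in> X)))\<rparr>"

context
  fixes L :: "'r set"
  assumes L: "left_ideal L"
begin

lemma coset_eq_iff: "coset L a = coset L b \<longleftrightarrow> a - b \<in> L"
proof
  have "a \<in> coset L a"
    using L by (simp add: coset_def left_ideal_def)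
  then show "a - b \<in> L" if "coset L a = coset L b"
    using that by (metis coset_def mem_Collect_eq)
next
  assume ab: "a - b \<in> L"
  have diff: "x - y \<in> L" if "x \<in> L" "y \<in> L" for x y
    using L that by (simp add: left_ideal_def)
  have "0 \<in> L"
    using L by (simp add: left_ideal_def)
  have "x - a \<in> L \<longleftrightarrow> x - b \<in> L" for x
  proof
    assume "x - a \<in> L"
    then show "x - b \<in> L"
      using diff[OF _ diff[OF \<open>0 \<in> L\<close> ab], of "x - a"] by simp
  next
    assume "x - b \<in> L"
    then show "x - a \<in> L"
      using diff[OF _ ab, of "x - b"] by simp
  qed
  then show "coset L a = coset L b"
    by (auto simp: coset_def)
qed

lemma coset_rep: "(SOME x. x \<in> coset L a) - a \<in> L"
proof -
  have "a \<in> coset L a"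
    using L by (simp add: coset_def left_ideal_def)
  then have "(SOME x. x \<in> coset L a) \<in> coset L a"
    by (rule someI)
  then show ?thesis
    by (simp add: coset_def)
qed

lemma quotient_simps:
  "carrier (quotient_module L) = range (coset L)"
  "\<zero>\<^bsub>quotient_module L\<^esub> = coset L 0"
  "coset L a \<oplus>\<^bsub>quotient_module L\<^esub> coset L b = coset L (a + b)"
  "r \<odot>\<^bsub>quotient_module L\<^esub> coset L a = coset L (m r a)"
proof -
  let ?a = "SOME x. x \<in> coset L a" and ?b = "SOME x. x \<in> coset L b"
  have "?a - a - (0 - (?b - b)) \<in> L"
    using L coset_rep unfolding left_ideal_def by blast
  then show "coset L a \<oplus>\<^bsub>quotient_module L\<^esub> coset L b = coset L (a + b)"
    by (simp add: quotient_module_def coset_eq_iff algebra_simps)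
  have "m r (?a - a) \<in> L"
    using L coset_rep unfolding left_ideal_def by blast
  then show "r \<odot>\<^bsub>quotient_module L\<^esub> coset L a = coset L (m r a)"
    by (simp add: quotient_module_def coset_eq_iff m_diff)
qed (simp_all add: quotient_module_def)

lemma quotient_action: "additive_ring_action (quotient_module L)"
proof -
  have "abelian_group (quotient_module L)"
  proof (rule abelian_groupI)
    fix X assume "X \<in> carrier (quotient_module L)"
    then obtain a where "X = coset L a"
      by (auto simp: quotient_simps)
    then have "coset L (- a) \<oplus>\<^bsub>quotient_module L\<^esub> X = \<zero>\<^bsub>quotient_module L\<^esub>"
      by (simp add: quotient_simps)
    then show "\<exists>Y\<in>carrier (quotient_module L).
        Y \<oplus>\<^bsub>quotient_module L\<^esub> X = \<zero>\<^bsub>quotient_module L\<^esub>"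
      by (auto simp: quotient_simps)
  qed (auto simp: quotient_simps ac_simps)
  moreover have "additive_ring_action_axioms (quotient_module L)"
    by unfold_locales (auto simp: quotient_simps m_add_left m_add_right)
  ultimately show ?thesis
    by (simp add: additive_ring_action_def)
qed

lemma quotient_submodule:
  assumes N: "ring_submodule N (quotient_module L)"
  shows "left_ideal {a. coset L a \<in> N}"
proof -
  interpret Q: additive_ring_action "quotient_module L"
    by (rule quotient_action)
  interpret N: subgroup N "add_monoid (quotient_module L)"
    using N by (simp add: ring_submodule_def)
  have add: "coset L (a + b) \<in> N" if "coset L a \<in> N" "coset L b \<in> N" for a b
    using N.m_closed[OF that] by (simp add: quotient_simps)
  have neg: "coset L (- a) \<in> N" if "coset L a \<in> N" for a
  proof -
    have "\<ominus>\<^bsub>quotient_module L\<^esub> coset L a = coset L (- a)"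
      by (rule Q.minus_equality) (auto simp: quotient_simps)
    then show ?thesis
      using N.m_inv_closed[OF that] by (simp add: a_inv_def)
  qed
  have "coset L 0 \<in> N"
    using N.one_closed by (simp add: quotient_simps)
  moreover have "coset L (a - b) \<in> N" if "coset L a \<in> N" "coset L b \<in> N" for a b
    using add[OF that(1) neg[OF that(2)]] by simp
  moreover have "coset L (m r a) \<in> N" if "coset L a \<in> N" for r a
    using N that by (auto simp: ring_submodule_def simp flip: quotient_simps(4))
  ultimately show ?thesis
    by (simp add: left_ideal_def)
qed

end

lemma maximal_modular_ideal:
  assumes L0: "left_ideal L0" "e \<notin> L0"
  shows "\<exists>L. left_ideal L \<and> L0 \<subseteq> L \<and> e \<notin> L \<and> (\<forall>K. left_ideal K \<longrightarrow> L \<subseteq> K \<longrightarrow> e \<notin> K \<longrightarrow> K = L)"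
proof -
  let ?A = "{L. left_ideal L \<and> L0 \<subseteq> L \<and> e \<notin> L}"
  have "\<exists>L\<in>?A. \<forall>K\<in>?A. L \<subseteq> K \<longrightarrow> K = L"
  proof (rule subset_Zorn_nonempty)
    fix C assume C: "C \<noteq> {}" "subset.chain ?A C"
    then have mem: "\<And>K. K \<in> C \<Longrightarrow> left_ideal K \<and> L0 \<subseteq> K \<and> e \<notin> K"
      by (auto simp: subset.chain_def)
    have "left_ideal (\<Union>C)"
      unfolding left_ideal_def
    proof (intro conjI ballI allI)
      show "0 \<in> \<Union>C"
        using C(1) mem by (auto simp: left_ideal_def)
      fix x assume "x \<in> \<Union>C"
      then obtain X where X: "X \<in> C" "x \<in> X" by blast
      then show "m r x \<in> \<Union>C" for r
        using mem[OF X(1)] by (auto simp: left_ideal_def intro!: bexI[of _ X])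
      fix y assume "y \<in> \<Union>C"
      then obtain Y where Y: "Y \<in> C" "y \<in> Y" by blast
      have "X \<subseteq> Y \<or> Y \<subseteq> X"
        using C(2) X(1) Y(1) by (auto simp: subset.chain_def)
      then obtain Z where Z: "Z \<in> C" "x \<in> Z" "y \<in> Z"
        using X Y by blast
      then have "x - y \<in> Z"
        using mem[OF Z(1)] by (simp add: left_ideal_def)
      then show "x - y \<in> \<Union>C"
        using Z(1) by blast
    qed
    then show "\<Union>C \<in> ?A"
      using C(1) mem by blast
  qed (use L0 in blast)
  then obtain L where L: "left_ideal L" "L0 \<subseteq> L" "e \<notin> L"
    and maximal: "\<And>K. K \<in> ?A \<Longrightarrow> L \<subseteq> K \<Longrightarrow> K = L"
    by auto
  have "K = L" if "left_ideal K" "L \<subseteq> K" "e \<notin> K" for K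
    using maximal[of K] L(2) that by auto
  with L show ?thesis
    by auto
qed

text \<open>
  Let \<open>L0\<close> be the union of the increasing left annihilators of the \<open>f n\<close>.  Modulo \<open>L0\<close> all \<open>f n\<close>
  agree with \<open>f 0\<close>, and \<open>f 0\<close> is a right unit.  So for a left ideal maximal among those that
  contain \<open>L0\<close> but not \<open>f 0\<close>, a larger one contains \<open>f 0\<close> and thus everything, which is simplicity;
  and the annihilator of the quotient contains no \<open>f n\<close>, which is faithfulness.
\<close>

lemma simple_faithful_quotient:
  fixes f :: "nat \<Rightarrow> 'r"
  assumes nonzero: "\<And>n. f n \<noteq> 0"
    and below: "\<And>i n. i \<le> n \<Longrightarrow> m (f i) (f n) = f n" "\<And>i n. i \<le> n \<Longrightarrow> m (f n) (f i) = f n"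
    and sep: "\<And>P. left_ideal P \<Longrightarrow> (\<And>x r. x \<in> P \<Longrightarrow> m x r \<in> P) \<Longrightarrow> P \<noteq> {0} \<Longrightarrow> \<exists>n. f n \<in> P"
  shows "\<exists>M :: ('r, 'r set) module. additive_ring_action M \<and>
    (\<forall>x\<in>carrier M. \<forall>r s. m r s \<odot>\<^bsub>M\<^esub> x = r \<odot>\<^bsub>M\<^esub> (s \<odot>\<^bsub>M\<^esub> x)) \<and>
    simple_module M \<and> faithful_module M"
proof -
  define L0 where "L0 = {r. \<exists>n. m r (f n) = 0}"
  have mono: "m x (f k) = 0" if "m x (f n) = 0" "n \<le> k" for x n k
    using that below(1)[of n k] by (metis m_assoc m_zero(1))
  have "left_ideal L0"
    unfolding left_ideal_def
  proof (intro conjI ballI allI)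
    show "0 \<in> L0"
      by (simp add: L0_def m_zero)
    fix x assume "x \<in> L0"
    then obtain i where i: "m x (f i) = 0"
      by (auto simp: L0_def)
    then show "m r x \<in> L0" for r
      by (auto simp: L0_def m_assoc m_zero intro!: exI[of _ i])
    fix y assume "y \<in> L0"
    then obtain j where j: "m y (f j) = 0"
      by (auto simp: L0_def)
    have "m (x - y) (f (max i j)) = 0"
      using mono[OF i, of "max i j"] mono[OF j, of "max i j"] by (simp add: m_diff)
    then show "x - y \<in> L0"
      by (auto simp: L0_def)
  qed
  moreover have "f 0 \<notin> L0"
    using nonzero below(1) by (auto simp: L0_def)
  ultimately obtain L where L: "left_ideal L" "L0 \<subseteq> L" "f 0 \<notin> L"
    and maximal: "\<And>K. left_ideal K \<Longrightarrow> L \<subseteq> K \<Longrightarrow> f 0 \<notin> K \<Longrightarrow> K = L"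
    using maximal_modular_ideal by metis
  note simps = quotient_simps[OF L(1)] coset_eq_iff[OF L(1)]
  have closed: "0 \<in> L" "\<And>x y. x \<in> L \<Longrightarrow> y \<in> L \<Longrightarrow> x - y \<in> L" "\<And>x r. x \<in> L \<Longrightarrow> m r x \<in> L"
    using L(1) by (auto simp: left_ideal_def)
  have modular: "r - m r (f 0) \<in> L" for r
    using L(2) below(1)[of 0 0] by (auto simp: L0_def m_diff m_assoc intro!: exI[of _ 0])
  have "simple_module (quotient_module L)"
    unfolding simple_module_def
  proof (intro conjI allI impI)
    show "\<exists>r. \<exists>x\<in>carrier (quotient_module L).
        r \<odot>\<^bsub>quotient_module L\<^esub> x \<noteq> \<zero>\<^bsub>quotient_module L\<^esub>"
      using L(3) below(1)[of 0 0]
      by (intro exI[of _ "f 0"] bexI[of _ "coset L (f 0)"])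
        (simp add: simps, simp add: quotient_simps(1)[OF L(1)])
    fix N assume N: "ring_submodule N (quotient_module L)"
    then have subgroup: "subgroup N (add_monoid (quotient_module L))"
      by (simp add: ring_submodule_def)
    then have sub: "N \<subseteq> range (coset L)" and zero: "coset L 0 \<in> N"
      using subgroup.subset[OF subgroup] subgroup.one_closed[OF subgroup]
      by (simp_all add: quotient_simps[OF L(1)])
    define K where "K = {a. coset L a \<in> N}"
    have K: "left_ideal K"
      unfolding K_def by (rule quotient_submodule[OF L(1) N])
    have absorb: "coset L a = coset L 0" if "a \<in> L" for a
      using that by (simp add: simps)
    with zero have "L \<subseteq> K"
      by (auto simp: K_def)
    have N_eq: "N = coset L ` K"
      using sub by (auto simp: K_def)
    show "N = {\<zero>\<^bsub>quotient_module L\<^esub>} \<or> N = carrier (quotient_module L)"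
    proof (cases "f 0 \<in> K")
      case True
      have "r \<in> K" for r
      proof -
        have "r - m r (f 0) \<in> K" "m r (f 0) \<in> K" "0 \<in> K"
          using K True modular \<open>L \<subseteq> K\<close> by (auto simp: left_ideal_def)
        then have "(r - m r (f 0)) - (0 - m r (f 0)) \<in> K"
          using K unfolding left_ideal_def by blast
        then show ?thesis
          by simp
      qed
      then have "K = UNIV"
        by auto
      then show ?thesis
        by (simp add: N_eq simps)
    next
      case False
      then have "K = L"
        using maximal[OF K \<open>L \<subseteq> K\<close>] by simp
      then have "N = {coset L 0}"
        using closed(1) absorb N_eq by (metis empty_iff image_constant_conv image_cong)
      then show ?thesis
        by (simp add: simps)
    qed
  qed
  moreover have "faithful_module (quotient_module L)"
  proof -
    define P where "P = {r. \<forall>a. m r a \<in> L}"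
    have "left_ideal P"
      using closed by (auto simp: left_ideal_def P_def m_zero m_diff m_assoc)
    moreover have "m x r \<in> P" if "x \<in> P" for x r
      using that by (simp add: P_def m_assoc)
    moreover have "f n \<notin> P" for n
    proof
      assume "f n \<in> P"
      then have "f n \<in> L"
        using below(1)[of n n] by (auto simp: P_def dest: spec[of _ "f n"])
      moreover have "f 0 - f n \<in> L"
        using L(2) below(1)[of 0 n] below(1)[of n n]
        by (auto simp: L0_def m_diff intro!: exI[of _ n])
      ultimately have "f 0 - f n - (0 - f n) \<in> L"
        using closed by blast
      then show False
        using L(3) by simp
    qed
    ultimately have "P = {0}"
      using sep by blast
    moreover have "r \<in> P" if "\<forall>x\<in>carrier (quotient_module L).
        r \<odot>\<^bsub>quotient_module L\<^esub> x = \<zero>\<^bsub>quotient_module L\<^esub>" for r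
      using that by (simp add: P_def simps)
    ultimately show ?thesis
      by (auto simp: faithful_module_def)
  qed
  moreover have "\<forall>x\<in>carrier (quotient_module L). \<forall>r s. m r s \<odot>\<^bsub>quotient_module L\<^esub> x =
      r \<odot>\<^bsub>quotient_module L\<^esub> (s \<odot>\<^bsub>quotient_module L\<^esub> x)"
    by (auto simp: simps m_assoc closed(1))
  ultimately show ?thesis
    using quotient_action[OF L(1)] by blast
qed

end

theorem theorem3p2:
  fixes scale :: "'k::field \<Rightarrow> 'r::ring \<Rightarrow> 'r"
  assumes "nonunital_algebra scale"
    and "prime_ring TYPE('r)"
    and "\<And>I :: 'r set. \<lbrakk>right_ideal I; I \<noteq> {0}\<rbrakk> \<Longrightarrow>
           \<exists>e\<in>I. e \<noteq> 0 \<and> e * e = e \<and> field (corner_center e)"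
    and "nonunital_algebra.countable_dimension scale"
  shows "left_primitive TYPE('r) \<and> right_primitive TYPE('r)"
proof -
  interpret nonunital_algebra scale by fact
  interpret field_idempotent_algebra scale
  proof
    show "\<exists>x. a * x * b \<noteq> 0" if "a \<noteq> 0" "b \<noteq> 0" for a b :: 'r
      using prime_ring_elements[OF assms(2) that] .
    show "\<exists>e\<in>I. field_idempotent e" if "right_ideal I" "I \<noteq> {0}" for I :: "'r set"
      using assms(3)[OF that] field_idempotentI by blast
  qed
  have "\<exists>x :: 'r. x \<noteq> 0"
    using assms(2) by (simp add: prime_ring_def)
  then obtain f :: "nat \<Rightarrow> 'r" where f: "\<And>n. f n \<noteq> 0"
    "\<And>i n. i \<le> n \<Longrightarrow> f i * f n = f n" "\<And>i n. i \<le> n \<Longrightarrow> f n * f i = f n"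
    and sep: "\<And>I. two_sided_ideal I \<Longrightarrow> I \<noteq> {0} \<Longrightarrow> \<exists>n. f n \<in> I"
    using separating_chain[OF assms(4)] by metis
  interpret l: ring_multiplication "(*) :: 'r \<Rightarrow> 'r \<Rightarrow> 'r"
    by unfold_locales (simp_all add: algebra_simps)
  interpret r: ring_multiplication "\<lambda>x y :: 'r. y * x"
    by unfold_locales (simp_all add: algebra_simps)
  have "left_primitive TYPE('r)"
  proof -
    have "\<exists>n. f n \<in> P" if "l.left_ideal P" "\<And>x r. x \<in> P \<Longrightarrow> x * r \<in> P" "P \<noteq> {0}" for P
      using that by (intro sep two_sided_idealI) (auto simp: l.left_ideal_def)
    from l.simple_faithful_quotient[OF f(1,2,3) this] show ?thesis
      unfolding left_primitive_def left_ring_module_def left_ring_module_axioms_def by blast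
  qed
  moreover have "right_primitive TYPE('r)"
  proof -
    have "\<exists>n. f n \<in> P" if "r.left_ideal P" "\<And>x r. x \<in> P \<Longrightarrow> r * x \<in> P" "P \<noteq> {0}" for P
      using that by (intro sep two_sided_idealI) (auto simp: r.left_ideal_def)
    from r.simple_faithful_quotient[OF f(1,3,2) this] show ?thesis
      unfolding right_primitive_def right_ring_module_def right_ring_module_axioms_def by blast
  qed
  ultimately show ?thesis ..
qed

end
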